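(* Let $n\ge 4$. Consider the board obtained from the $C_n$ board (a cycle graph with $n$ vertices embedded in the plane) by adding one internal chord connecting two non-adjacent vertices of the cycle, so that the board has two bounded cells. In the Game of Cycles on this board, if $n$ is even then Player~1 has a winning strategy, and if $n$ is odd then Player~2 has a winning strategy.
   Context: The Game of Cycles. A board is a simple connected planar graph embedded in the plane, together with its bounded cells. Two players alternate turns; on a turn a player marks one unmarked edge with an arrow pointing along the edge in one of its two directions. Each edge receives at most one arrow, and arrows have the same effect regardless of who placed them. Moves must obey the sink-source rule: no move may create a sink (a vertex all of whose incident edges are marked with arrows pointing toward it) or a source (a vertex all of whose incident edges are marked with arrows pointing away from it). A player who has a legal move must make one. A cycle cell is a bounded cell all of whose boundary edges are marked with arrows all cycling in the same direction around that cell. The first player to create a cycle cell wins; if play ends (no legal move remains) without a cycle cell, the player who made the last move wins. A winning strategy guarantees a win regardless of the opponent's moves. *)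

theory Defs
  imports Main
begin

text \<open>A board: finitely many edges (natural-number ids), each with a reference
  orientation from bsrc to btgt, and the bounded cells.  A cell is given as the
  set of its boundary edges, each paired with a flag telling whether the
  reference orientation of the edge agrees with a fixed cyclic traversal of the
  cell boundary.\<close>

record board =
  bedges :: "nat set"
  bsrc :: "nat \<Rightarrow> nat"
  btgt :: "nat \<Rightarrow> nat"
  bcells :: "(nat \<times> bool) set set"

text \<open>A position: each edge is unmarked (None) or carries an arrow:
  Some True = arrow from bsrc to btgt, Some False = arrow from btgt to bsrc.\<close>

type_synonym position = "nat \<Rightarrow> bool option"

definition vertices :: "board \<Rightarrow> nat set" where
  "vertices B = bsrc B ` bedges B \<union> btgt B ` bedges B"

definition incident :: "board \<Rightarrow> nat \<Rightarrow> nat \<Rightarrow> bool" where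
  "incident B e v \<longleftrightarrow> bsrc B e = v \<or> btgt B e = v"

definition points_to :: "board \<Rightarrow> position \<Rightarrow> nat \<Rightarrow> nat \<Rightarrow> bool" where
  "points_to B s e v \<longleftrightarrow>
     (s e = Some True \<and> btgt B e = v) \<or> (s e = Some False \<and> bsrc B e = v)"

definition points_away :: "board \<Rightarrow> position \<Rightarrow> nat \<Rightarrow> nat \<Rightarrow> bool" where
  "points_away B s e v \<longleftrightarrow>
     (s e = Some True \<and> bsrc B e = v) \<or> (s e = Some False \<and> btgt B e = v)"

definition is_sink :: "board \<Rightarrow> position \<Rightarrow> nat \<Rightarrow> bool" where
  "is_sink B s v \<longleftrightarrow> v \<in> vertices B \<and>
     (\<forall>e\<in>bedges B. incident B e v \<longrightarrow> points_to B s e v)"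

definition is_source :: "board \<Rightarrow> position \<Rightarrow> nat \<Rightarrow> bool" where
  "is_source B s v \<longleftrightarrow> v \<in> vertices B \<and>
     (\<forall>e\<in>bedges B. incident B e v \<longrightarrow> points_away B s e v)"

definition no_sink_source :: "board \<Rightarrow> position \<Rightarrow> bool" where
  "no_sink_source B s \<longleftrightarrow> (\<forall>v. \<not> is_sink B s v \<and> \<not> is_source B s v)"

definition legal_move :: "board \<Rightarrow> position \<Rightarrow> nat \<Rightarrow> bool \<Rightarrow> bool" where
  "legal_move B s e d \<longleftrightarrow>
     e \<in> bedges B \<and> s e = None \<and> no_sink_source B (s(e := Some d))"

definition has_move :: "board \<Rightarrow> position \<Rightarrow> bool" where
  "has_move B s \<longleftrightarrow> (\<exists>e d. legal_move B s e d)"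

definition cycle_cell :: "position \<Rightarrow> (nat \<times> bool) set \<Rightarrow> bool" where
  "cycle_cell s c \<longleftrightarrow>
     (\<forall>(e, b)\<in>c. s e = Some b) \<or> (\<forall>(e, b)\<in>c. s e = Some (\<not> b))"

definition has_cycle_cell :: "board \<Rightarrow> position \<Rightarrow> bool" where
  "has_cycle_cell B s \<longleftrightarrow> (\<exists>c\<in>bcells B. cycle_cell s c)"

text \<open>mover_wins B m s: the player to move in position s (with m unmarked
  edges, used as fuel) has a winning strategy.  A move wins immediately if it
  creates a cycle cell or leaves the opponent with no legal move; otherwise the
  opponent must not have a winning strategy from the resulting position.\<close>

fun mover_wins :: "board \<Rightarrow> nat \<Rightarrow> position \<Rightarrow> bool" where
  "mover_wins B 0 s = False"
| "mover_wins B (Suc m) s =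
     (\<exists>e d. legal_move B s e d \<and>
        (has_cycle_cell B (s(e := Some d)) \<or> \<not> has_move B (s(e := Some d))
         \<or> \<not> mover_wins B m (s(e := Some d))))"

definition first_player_wins :: "board \<Rightarrow> bool" where
  "first_player_wins B \<longleftrightarrow> mover_wins B (card (bedges B)) (\<lambda>_. None)"

definition second_player_wins :: "board \<Rightarrow> bool" where
  "second_player_wins B \<longleftrightarrow>
     (\<forall>e d. legal_move B (\<lambda>_. None) e d \<longrightarrow>
        \<not> has_cycle_cell B ((\<lambda>_. None)(e := Some d)) \<and>
        has_move B ((\<lambda>_. None)(e := Some d)) \<and>
        mover_wins B (card (bedges B) - 1) ((\<lambda>_. None)(e := Some d)))"

text \<open>The C_n board (vertices 0..n-1, edge i from i to (i+1) mod n for i < n)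
  with the chord n joining vertices 0 and k.  Its two bounded cells are bounded
  by 0 -> 1 -> ... -> k -> 0 and by k -> k+1 -> ... -> n-1 -> 0 -> k.\<close>

definition chord_board :: "nat \<Rightarrow> nat \<Rightarrow> board" where
  "chord_board n k =
    \<lparr> bedges = {..n},
      bsrc = (\<lambda>i. if i < n then i else 0),
      btgt = (\<lambda>i. if i < n then Suc i mod n else k),
      bcells = { {(i, True) | i. i < k} \<union> {(n, False)},
                 {(i, True) | i. k \<le> i \<and> i < n} \<union> {(n, True)} } \<rparr>"

end

theory Submission
  imports Defs
begin

text \<open>
  Reversing all arrows is a symmetry, so let the chord carry the arrow from vertex 0 to vertex k.
  Both paths of the cycle then join the tail of the chord to its head; call an arrow on them
  \<^emph>\<open>aligned\<close> if it points along its path in the direction of the chord and \<^emph>\<open>opposed\<close> otherwise.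
  The sink-source rule says that neighbouring edges of a path agree and that at either chord end
  the two end edges of the paths are not both aligned; a cell is completed when its path is entirely
  opposed.  If an aligned end edge is present at both chord ends, the position behaves like a plain cycle:
  unmarkable edges are exactly the sign changes around the cycle, so a blocked position has an
  even number of unmarked edges, and the player with the right parity wins by never leaving a path one
  arrow short of being opposed.

  Player 1 (n even) opens with the chord; Player 2 (n odd) answers an edge by the chord making that edge
  aligned, and the chord by an aligned end edge.  From there this player fixes an aligned
  end edge at each chord end within two moves.  The only obstruction is an opposed arrow in the middle
  of a path of length 3; then the position can be made symmetric under reflecting both
  paths, and copying the opponent's moves under the reflection wins.
\<close>

section \<open>Winning strategies and arrow reversal\<close>

text \<open>Coinduction replaces an induction on the number of unmarked edges: strategies become
  invariants, independent of the fuel of \<^const>\<open>mover_wins\<close>.\<close>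

coinductive lost :: "board \<Rightarrow> position \<Rightarrow> bool" for B where
  lostI: "(\<And>e d. legal_move B s e d \<Longrightarrow> \<not> has_cycle_cell B (s(e := Some d)) \<and>
      (\<exists>e' d'. legal_move B (s(e := Some d)) e' d' \<and>
        (has_cycle_cell B (s(e := Some d, e' := Some d')) \<or> lost B (s(e := Some d, e' := Some d')))))
    \<Longrightarrow> lost B s"

definition unmarked :: "board \<Rightarrow> position \<Rightarrow> nat" where
  "unmarked B s = card {e \<in> bedges B. s e = None}"

text \<open>A move that leaves the opponent blocked needs no clause of its own: \<open>lost\<close>
  holds vacuously of a position without legal moves.\<close>

definition reply :: "board \<Rightarrow> (position \<Rightarrow> bool) \<Rightarrow> position \<Rightarrow> bool" where
  "reply B P s \<longleftrightarrow> (\<exists>e d. legal_move B s e d \<and>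
     (has_cycle_cell B (s(e := Some d)) \<or> P (s(e := Some d))))"

lemma lost_if_reply:
  assumes "\<And>e d. legal_move B s e d \<Longrightarrow>
    \<not> has_cycle_cell B (s(e := Some d)) \<and> reply B (lost B) (s(e := Some d))"
  shows "lost B s"
  using assms unfolding reply_def by (intro lostI) simp

text \<open>A strategy is a set of positions to which the player can always return. A reply may also
  leave the set for a position already known to be \<open>lost\<close>, so strategies can be
  chained.\<close>

lemma lost_invariant:
  assumes "I s"
    and step: "\<And>s e d. I s \<Longrightarrow> legal_move B s e d \<Longrightarrow>
      \<not> has_cycle_cell B (s(e := Some d)) \<and> reply B (\<lambda>t. I t \<or> lost B t) (s(e := Some d))"
  shows "lost B s"
  using assms(1)
proof (coinduction arbitrary: s rule: lost.coinduct)
  case lost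
  then show ?case
    using step[OF lost] unfolding reply_def by blast
qed

lemma reply_mono: "reply B P s \<Longrightarrow> (\<And>t. P t \<Longrightarrow> Q t) \<Longrightarrow> reply B Q s"
  unfolding reply_def by blast

lemma unmarked_move:
  assumes "finite (bedges B)" "legal_move B s e d"
  shows "unmarked B s = Suc (unmarked B (s(e := Some d)))"
proof -
  have "{x \<in> bedges B. s x = None} = insert e {x \<in> bedges B. (s(e := Some d)) x = None}"
    using assms(2) by (auto simp: legal_move_def)
  then show ?thesis
    using assms(1) by (simp add: unmarked_def)
qed

text \<open>A move and its reply use up two units of fuel, hence the strong induction. The bound on
  \<open>unmarked\<close> guarantees that fuel is left for the reply.\<close>

lemma lost_imp_not_mover_wins:
  assumes "finite (bedges B)"
  shows "lost B s \<Longrightarrow> unmarked B s \<le> m \<Longrightarrow> \<not> mover_wins B m s"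
proof (induction m arbitrary: s rule: less_induct)
  case (less m)
  show ?case
  proof
    assume "mover_wins B m s"
    then obtain m' e d where m: "m = Suc m'" and l: "legal_move B s e d"
      and w: "has_cycle_cell B (s(e := Some d)) \<or> \<not> has_move B (s(e := Some d))
        \<or> \<not> mover_wins B m' (s(e := Some d))"
      by (cases m) auto
    let ?t = "s(e := Some d)"
    obtain e' d' where nc: "\<not> has_cycle_cell B ?t" and l': "legal_move B ?t e' d'"
      and w': "has_cycle_cell B (?t(e' := Some d')) \<or> lost B (?t(e' := Some d'))"
      using less.prems(1) l by (metis lost.cases)
    have u: "unmarked B ?t = Suc (unmarked B (?t(e' := Some d')))" "unmarked B s = Suc (unmarked B ?t)"
      using unmarked_move[OF assms l] unmarked_move[OF assms l'] by auto
    then obtain m'' where m'': "m' = Suc m''" "unmarked B (?t(e' := Some d')) \<le> m''"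
      using less.prems(2) m by (cases m') auto
    have "mover_wins B m' ?t"
      using l' w' less.IH[of m'' "?t(e' := Some d')"] m'' m
      by (metis diff_Suc_1 lessI less_Suc_eq mover_wins.simps(2))
    moreover have "has_move B ?t"
      using l' by (auto simp: has_move_def)
    ultimately show False
      using w nc by blast
  qed
qed

lemma reply_imp_mover_wins:
  assumes "finite (bedges B)" "reply B (lost B) s" "unmarked B s \<le> m"
  shows "mover_wins B m s"
proof -
  obtain e d where l: "legal_move B s e d"
    and w: "has_cycle_cell B (s(e := Some d)) \<or> lost B (s(e := Some d))"
    using assms(2) by (auto simp: reply_def)
  then obtain m' where "m = Suc m'" "unmarked B (s(e := Some d)) \<le> m'"
    using unmarked_move[OF assms(1) l] assms(3) by (cases m) auto
  then show ?thesis
    using l w lost_imp_not_mover_wins[OF assms(1)] by auto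
qed

section \<open>Symmetry under reversing all arrows\<close>

definition reverse :: "position \<Rightarrow> position" where
  "reverse s = (\<lambda>e. map_option Not (s e))"

lemma reverse_upd: "reverse (s(e := Some d)) = (reverse s)(e := Some (\<not> d))"
  by (auto simp: reverse_def)

lemma reverse_eq_Some: "reverse s e = Some d \<longleftrightarrow> s e = Some (\<not> d)"
  by (cases "s e") (auto simp: reverse_def)

lemma no_sink_source_reverse: "no_sink_source B (reverse s) = no_sink_source B s"
  by (auto simp: no_sink_source_def is_sink_def is_source_def points_to_def points_away_def
    reverse_eq_Some)

lemma legal_move_reverse: "legal_move B (reverse s) e d = legal_move B s e (\<not> d)"
proof -
  have "(reverse s)(e := Some d) = reverse (s(e := Some (\<not> d)))"
    by (simp add: reverse_upd)
  then show ?thesis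
    by (simp add: legal_move_def no_sink_source_reverse) (simp add: reverse_def)
qed

lemma has_move_reverse: "has_move B (reverse s) = has_move B s"
  by (auto simp: has_move_def legal_move_reverse ex_bool_eq)

lemma has_cycle_cell_reverse: "has_cycle_cell B (reverse s) = has_cycle_cell B s"
proof -
  have "cycle_cell (reverse s) c = cycle_cell s c" for c
    by (auto simp: cycle_cell_def reverse_eq_Some)
  then show ?thesis
    by (simp add: has_cycle_cell_def)
qed

lemma mover_wins_reverse: "mover_wins B m (reverse s) = mover_wins B m s"
proof (induction m arbitrary: s)
  case (Suc m)
  have "mover_wins B (Suc m) (reverse s) = (\<exists>e d. legal_move B s e (\<not> d) \<and>
     (has_cycle_cell B (reverse (s(e := Some (\<not> d)))) \<or> \<not> has_move B (reverse (s(e := Some (\<not> d))))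
         \<or> \<not> mover_wins B m (reverse (s(e := Some (\<not> d))))))"
    by (simp add: legal_move_reverse reverse_upd)
  also have "\<dots> = (\<exists>e d. legal_move B s e (\<not> d) \<and>
     (has_cycle_cell B (s(e := Some (\<not> d))) \<or> \<not> has_move B (s(e := Some (\<not> d)))
         \<or> \<not> mover_wins B m (s(e := Some (\<not> d)))))"
    by (simp only: has_cycle_cell_reverse has_move_reverse Suc.IH)
  also have "\<dots> = mover_wins B (Suc m) s"
    by (simp add: ex_bool_eq disj_commute)
  finally show ?case .
qed simp

text \<open>A sink or source needs all its incident edges marked, so erasing arrows creates
  none.\<close>

lemma no_sink_source_antimono:
  assumes "s \<subseteq>\<^sub>m t" "no_sink_source B t"
  shows "no_sink_source B s"
proof -
  have *: "s e = Some d \<Longrightarrow> t e = Some d" for e d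
    using assms(1) by (metis domI map_le_def)
  show ?thesis
    using assms(2) unfolding no_sink_source_def is_sink_def is_source_def points_to_def points_away_def
    by (meson *)
qed

text \<open>Marked neighbours agree, and every unmarked index is isolated and separates opposite
  marks. The mark therefore flips exactly once per gap, and comparing the first with the last mark
  gives the parity of the gaps.\<close>

lemma run_parity:
  fixes f :: "nat \<Rightarrow> bool option"
  assumes start: "f 0 = Some a"
    and adj: "\<And>i d. i < N \<Longrightarrow> f i = Some d \<Longrightarrow> f (Suc i) \<noteq> Some (\<not> d)"
    and gap: "\<And>i. Suc i < N \<Longrightarrow> f (Suc i) = None \<Longrightarrow> \<exists>d. f i = Some d \<and> f (Suc (Suc i)) = Some (\<not> d)"
  shows "j \<le> N \<Longrightarrow> f j = Some d \<Longrightarrow> even (card {i. i < j \<and> f i = None}) \<longleftrightarrow> d = a"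
proof (induction j arbitrary: d rule: less_induct)
  case (less j)
  show ?case
  proof (cases j)
    case 0
    then show ?thesis
      using less.prems start by simp
  next
    case (Suc j')
    show ?thesis
    proof (cases "f j'")
      case (Some d')
      then have "{i. i < j \<and> f i = None} = {i. i < j' \<and> f i = None}"
        using Suc by (auto simp: less_Suc_eq)
      moreover have "d' = d"
        using adj[of j' d'] Some Suc less.prems by auto
      ultimately show ?thesis
        using less.IH[of j' d'] Some Suc less.prems by simp
    next
      case None
      then obtain i where i: "j' = Suc i"
        using start by (cases j') auto
      then obtain d' where d': "f i = Some d'" "f j = Some (\<not> d')"
        using gap[of i] None Suc less.prems by auto
      have "{i. i < j \<and> f i = None} = insert j' {x. x < i \<and> f x = None}"
        using Suc i None d' by (auto simp: less_Suc_eq)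
      then show ?thesis
        using less.IH[of i d'] d' Suc i less.prems by auto
    qed
  qed
qed

section \<open>The chord board\<close>

text \<open>The bounds express that 0 and \<open>k\<close> are not adjacent: the two paths have
  \<open>k\<close> and \<open>n - k\<close> edges, at least two each.\<close>

locale chord_game =
  fixes n k :: nat
  assumes k_ge: "2 \<le> k" and n_ge: "k + 2 \<le> n"
begin

abbreviation B :: board where "B \<equiv> chord_board n k"

text \<open>The path of a cell is named by a boolean, \<^term>\<open>True\<close> for the edges below k; with the chord
  directed from 0 to k, this boolean is also the mark of an aligned edge of that path.
  The second boolean selects the chord end: \<^term>\<open>True\<close> for vertex 0, \<^term>\<open>False\<close> for vertex k.\<close>

definition end_edge :: "bool \<Rightarrow> bool \<Rightarrow> nat" where
  "end_edge z v = (if z then if v then 0 else k - 1 else if v then n - 1 else k)"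

text \<open>On a path of length 2 this is the end edge at the other chord end, and on a path of
  length 3 both chord ends share it. Both degenerate cases matter in
  \<open>fresh_lost\<close>.\<close>

definition second_edge :: "bool \<Rightarrow> bool \<Rightarrow> nat" where
  "second_edge z v = (if z then if v then 1 else k - 2 else if v then n - 2 else k + 1)"

text \<open>The sink-source rule for a chord directed from 0 to \<open>k\<close>. The first conjunct
  treats the vertices of degree two. At 0 only a source and at \<open>k\<close> only a sink can
  arise, in either case from two aligned end edges.\<close>

definition consistent :: "position \<Rightarrow> bool" where
  "consistent s \<longleftrightarrow>
     (\<forall>i d. Suc i < n \<longrightarrow> Suc i \<noteq> k \<longrightarrow> s i = Some d \<longrightarrow> s (Suc i) \<noteq> Some (\<not> d)) \<and>
     (\<forall>v. \<not> (s (end_edge True v) = Some True \<and> s (end_edge False v) = Some False))"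

definition full :: "bool \<Rightarrow> position \<Rightarrow> bool" where
  "full z s \<longleftrightarrow> (\<forall>e<n. (e < k) = z \<longrightarrow> s e = Some (\<not> z))"

lemma bedges_B [simp]: "bedges B = {..n}"
  by (simp add: chord_board_def)

lemma vertices_B: "vertices B = {..<n}"
proof -
  have "bsrc B ` {..n} \<subseteq> {..<n}" "btgt B ` {..n} \<subseteq> {..<n}"
    using k_ge n_ge by (auto simp: chord_board_def)
  moreover have "v \<in> bsrc B ` {..n}" if "v < n" for v
    using that by (intro image_eqI[of _ _ v]) (auto simp: chord_board_def)
  ultimately show ?thesis
    by (auto simp: vertices_def)
qed

lemma bsrc_B: "bsrc B e = (if e < n then e else 0)"
  by (simp add: chord_board_def)

lemma btgt_B: "btgt B e = (if e < n - 1 then Suc e else if e = n - 1 then 0 else k)"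
proof -
  have "Suc (n - 1) = n"
    using n_ge by simp
  then show ?thesis
    using n_ge by (auto simp: chord_board_def)
qed

lemma incident_edges:
  assumes "v < n"
  shows "{e. e \<le> n \<and> incident B e v} =
    {if v = 0 then n - 1 else v - 1, v} \<union> (if v = 0 \<or> v = k then {n} else {})"
proof -
  have "e \<le> n \<and> incident B e v \<longleftrightarrow>
    e = v \<or> e = (if v = 0 then n - 1 else v - 1) \<or> e = n \<and> (v = 0 \<or> v = k)" for e
  proof -
    consider "e < n - 1" | "e = n - 1" | "e = n" | "n < e"
      by linarith
    then show ?thesis
      using assms n_ge by cases (auto simp: incident_def bsrc_B btgt_B)
  qed
  then show ?thesis
    by auto
qed

lemma is_sink_B:
  "is_sink B s v \<longleftrightarrow> v < n \<and> s v = Some False \<and>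
     s (if v = 0 then n - 1 else v - 1) = Some True \<and>
     (v = 0 \<longrightarrow> s n = Some False) \<and> (v = k \<longrightarrow> s n = Some True)"
proof (cases "v < n")
  case True
  have "is_sink B s v \<longleftrightarrow> (\<forall>e \<in> {e. e \<le> n \<and> incident B e v}. points_to B s e v)"
    using True by (auto simp: is_sink_def vertices_B)
  also have "\<dots> \<longleftrightarrow> s v = Some False \<and> s (if v = 0 then n - 1 else v - 1) = Some True \<and>
     (v = 0 \<longrightarrow> s n = Some False) \<and> (v = k \<longrightarrow> s n = Some True)"
    using True k_ge n_ge unfolding incident_edges[OF True] points_to_def bsrc_B btgt_B
    by (cases "v = 0"; cases "v = k") auto
  finally show ?thesis
    using True by simp
qed (simp add: is_sink_def vertices_B)

lemma is_source_B:
  "is_source B s v \<longleftrightarrow> v < n \<and> s v = Some True \<and>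
     s (if v = 0 then n - 1 else v - 1) = Some False \<and>
     (v = 0 \<longrightarrow> s n = Some True) \<and> (v = k \<longrightarrow> s n = Some False)"
proof (cases "v < n")
  case True
  have "is_source B s v \<longleftrightarrow> (\<forall>e \<in> {e. e \<le> n \<and> incident B e v}. points_away B s e v)"
    using True by (auto simp: is_source_def vertices_B)
  also have "\<dots> \<longleftrightarrow> s v = Some True \<and> s (if v = 0 then n - 1 else v - 1) = Some False \<and>
     (v = 0 \<longrightarrow> s n = Some True) \<and> (v = k \<longrightarrow> s n = Some False)"
    using True k_ge n_ge unfolding incident_edges[OF True] points_away_def bsrc_B btgt_B
    by (cases "v = 0"; cases "v = k") auto
  finally show ?thesis
    using True by simp
qed (simp add: is_source_def vertices_B)

lemma consistent_iff:
  assumes "s n = Some True"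
  shows "no_sink_source B s \<longleftrightarrow> consistent s"
proof
  assume "no_sink_source B s"
  then have *: "\<not> is_sink B s v" "\<not> is_source B s v" for v
    by (auto simp: no_sink_source_def)
  have "s (Suc i) \<noteq> Some (\<not> d)" if "Suc i < n" "Suc i \<noteq> k" "s i = Some d" for i d
    using that *[of "Suc i"] unfolding is_sink_B is_source_B by (cases d) auto
  moreover have "\<not> (s 0 = Some True \<and> s (n - 1) = Some False)" "\<not> (s (k - 1) = Some True \<and> s k = Some False)"
    using *(2)[of 0] *(1)[of k] assms k_ge n_ge unfolding is_sink_B is_source_B by auto
  ultimately show "consistent s"
    by (simp add: consistent_def end_edge_def)
next
  assume c: "consistent s"
  then have adj: "\<And>i d. Suc i < n \<Longrightarrow> Suc i \<noteq> k \<Longrightarrow> s i = Some d \<Longrightarrow> s (Suc i) \<noteq> Some (\<not> d)"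
    unfolding consistent_def by blast
  have ends: "\<not> (s 0 = Some True \<and> s (n - 1) = Some False)" "\<not> (s (k - 1) = Some True \<and> s k = Some False)"
    using c spec[of "\<lambda>v. \<not> (s (end_edge True v) = Some True \<and> s (end_edge False v) = Some False)" True]
      spec[of "\<lambda>v. \<not> (s (end_edge True v) = Some True \<and> s (end_edge False v) = Some False)" False]
    by (auto simp: consistent_def end_edge_def)
  have "\<not> is_sink B s v \<and> \<not> is_source B s v" for v
  proof -
    consider "v = 0" | "v = k" | i where "v = Suc i" "Suc i \<noteq> k"
      by (cases v) auto
    then show ?thesis
    proof cases
      case 3
      then show ?thesis
        using adj[of i True] adj[of i False] unfolding is_sink_B is_source_B by auto
    qed (use ends assms k_ge in \<open>auto simp: is_sink_B is_source_B\<close>)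
  qed
  then show "no_sink_source B s"
    by (simp add: no_sink_source_def)
qed

text \<open>The chord arrow leaves one possible rotation per cell, the one in which the path leads
  back from \<open>k\<close> to 0.\<close>

lemma has_cycle_cell_B:
  assumes "s n = Some True"
  shows "has_cycle_cell B s \<longleftrightarrow> (\<exists>z. full z s)"
proof -
  have 1: "cycle_cell s ({(i, True) | i. i < k} \<union> {(n, False)}) \<longleftrightarrow> full True s"
    using assms n_ge by (auto simp: cycle_cell_def full_def ex_bool_eq)
  have 2: "cycle_cell s ({(i, True) | i. k \<le> i \<and> i < n} \<union> {(n, True)}) \<longleftrightarrow> full False s"
    using assms n_ge by (auto simp: cycle_cell_def full_def ex_bool_eq)
  have "has_cycle_cell B s \<longleftrightarrow> full True s \<or> full False s"
    by (simp add: has_cycle_cell_def chord_board_def 1[simplified] 2[simplified])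
  then show ?thesis
    by (metis (full_types))
qed

lemma no_cycle_cell_chord_unmarked:
  assumes "s n = None"
  shows "\<not> has_cycle_cell B s"
  using assms by (auto simp: has_cycle_cell_def chord_board_def cycle_cell_def)

section \<open>Parity strategy\<close>

text \<open>In a consistent position the other end edge is then not aligned, so the two end edges,
  if both marked, carry the same raw mark. The chord end obeys the rule of a vertex of degree
  two.\<close>

definition settled :: "bool \<Rightarrow> position \<Rightarrow> bool" where
  "settled v s \<longleftrightarrow> (\<exists>z. s (end_edge z v) = Some z)"

text \<open>The edge \<open>e\<close> may be unmarked, which is a threat, or already opposed, so
  that a full path counts as nearly full too.\<close>

definition nearly_full :: "bool \<Rightarrow> position \<Rightarrow> bool" where
  "nearly_full z s \<longleftrightarrow> (\<exists>e<n. (e < k) = z \<and> s e \<noteq> Some z \<and> full z (s(e := Some (\<not> z))))"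

lemma end_edge_props [simp]:
  "end_edge z v < n" "end_edge z v < k \<longleftrightarrow> z" "end_edge z v = end_edge z' v' \<longleftrightarrow> z = z' \<and> v = v'"
proof -
  show "end_edge z v < n" "end_edge z v < k \<longleftrightarrow> z"
    using k_ge n_ge by (auto simp: end_edge_def)
  show "end_edge z v = end_edge z' v' \<longleftrightarrow> z = z' \<and> v = v'"
    using k_ge n_ge by (cases z; cases v; cases z'; cases v') (simp add: end_edge_def; linarith)+
qed

lemma second_edge_props [simp]:
  "second_edge z v < n" "second_edge z v < k \<longleftrightarrow> z" "second_edge z v \<noteq> end_edge z v"
  using k_ge n_ge by (auto simp: second_edge_def end_edge_def)

lemma legal_iff:
  assumes "s n = Some True"
  shows "legal_move B s e d \<longleftrightarrow> e < n \<and> s e = None \<and> consistent (s(e := Some d))"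
proof (cases "e = n")
  case False
  then show ?thesis
    using assms consistent_iff[of "s(e := Some d)"] by (auto simp: legal_move_def)
qed (use assms in \<open>simp add: legal_move_def\<close>)

lemma unmarked_B:
  assumes "s n \<noteq> None"
  shows "unmarked B s = card {e. e < n \<and> s e = None}"
proof -
  have "{e \<in> {..n}. s e = None} = {e. e < n \<and> s e = None}"
    using assms by (auto simp: le_less)
  then show ?thesis
    by (simp add: unmarked_def)
qed

lemma consistentD:
  assumes "consistent s"
  shows "Suc i < n \<Longrightarrow> Suc i \<noteq> k \<Longrightarrow> s i = Some d \<Longrightarrow> s (Suc i) \<noteq> Some (\<not> d)"
    and "\<not> (s (end_edge z v) = Some z \<and> s (end_edge (\<not> z) v) = Some (\<not> z))"
proof -
  show "Suc i < n \<Longrightarrow> Suc i \<noteq> k \<Longrightarrow> s i = Some d \<Longrightarrow> s (Suc i) \<noteq> Some (\<not> d)"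
    using assms unfolding consistent_def by blast
  have "\<not> (s (end_edge True v) = Some True \<and> s (end_edge False v) = Some False)"
    using assms unfolding consistent_def by blast
  then show "\<not> (s (end_edge z v) = Some z \<and> s (end_edge (\<not> z) v) = Some (\<not> z))"
    by (cases z) auto
qed

text \<open>A veto comes from the preceding edge, from the following edge, or across a chord end. In
  the last case \<open>d\<close> serves both as the mark and as the name of the path on which this
  mark is aligned.\<close>

lemma conflict:
  assumes "consistent s" "s e = None" "\<not> consistent (s(e := Some d))"
  obtains i where "Suc i < n" "Suc i \<noteq> k" "e = Suc i" "s i = Some (\<not> d)"
  | "Suc e < n" "Suc e \<noteq> k" "s (Suc e) = Some (\<not> d)"
  | v where "e = end_edge d v" "s (end_edge (\<not> d) v) = Some (\<not> d)"
proof -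
  let ?t = "s(e := Some d)"
  consider i b where "Suc i < n" "Suc i \<noteq> k" "?t i = Some b" "?t (Suc i) = Some (\<not> b)"
    | v where "?t (end_edge True v) = Some True" "?t (end_edge False v) = Some False"
    using assms(3) unfolding consistent_def by blast
  then show thesis
  proof cases
    case 1
    then show thesis
      using consistentD(1)[OF assms(1) 1(1,2)] that(1,2) by (auto split: if_splits)
  next
    case 2
    then show thesis
      using consistentD(2)[OF assms(1), of True v] that(3)[of v]
      by (cases d) (auto split: if_splits)
  qed
qed

text \<open>A fully opposed path is uniform inside and has no aligned end edge, so it conflicts with
  nothing on the other path.\<close>

lemma consistent_full:
  assumes "consistent s" "full z t" "\<And>e. (e < k) \<noteq> z \<Longrightarrow> t e = s e"
  shows "consistent t"
proof -
  have "t (Suc i) \<noteq> Some (\<not> d)" if "Suc i < n" "Suc i \<noteq> k" "t i = Some d" for i d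
  proof (cases "(i < k) = z")
    case True
    then have "t i = Some (\<not> z)" "t (Suc i) = Some (\<not> z)"
      using assms(2) that by (auto simp: full_def)
    then show ?thesis
      using that by simp
  next
    case False
    then have "t i = s i" "t (Suc i) = s (Suc i)"
      using assms(3) that by auto
    then show ?thesis
      using consistentD(1)[OF assms(1) that(1,2)] that by simp
  qed
  moreover have "t (end_edge z v) = Some (\<not> z)" for v
    using assms(2) by (simp add: full_def)
  then have "\<not> (t (end_edge True v) = Some True \<and> t (end_edge False v) = Some False)" for v
    by (cases z) (metis option.inject)+
  ultimately show ?thesis
    unfolding consistent_def by blast
qed

text \<open>With both chord ends settled the marks obey the rule of a plain cycle, and an edge
  blocked in both directions lies between opposite marks. The unmarked edges are thus the sign
  changes around a closed cycle, which are even in number.\<close>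

lemma terminal_even:
  assumes chord: "s n = Some True" and c: "consistent s" and settled: "\<And>v. settled v s"
    and terminal: "\<And>e d. \<not> legal_move B s e d"
  shows "even (unmarked B s)"
proof -
  \<comment> \<open>Neighbours around the outer cycle, ignoring the chord.\<close>
  define prv where "prv e = (if e = 0 then n - 1 else e - 1)" for e
  define nxt where "nxt e = (if Suc e = n then 0 else Suc e)" for e
  have gap: "\<exists>d. s (prv e) = Some d \<and> s (nxt e) = Some (\<not> d)" if "e < n" "s e = None" for e
  proof -
    have e: "Suc e = n \<longleftrightarrow> e = n - 1"
      using that by auto
    have "s (prv e) = Some (\<not> d) \<or> s (nxt e) = Some (\<not> d)" for d
    proof -
      have "\<not> consistent (s(e := Some d))"
        using terminal[of e d] that chord by (simp add: legal_iff)
      from c that(2) this show ?thesis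
      proof (cases rule: conflict)
        case (3 v)
        then show ?thesis
          using k_ge n_ge e by (cases d; cases v) (auto simp: end_edge_def prv_def nxt_def)
      qed (auto simp: prv_def nxt_def)
    qed
    from this[of True] this[of False] show ?thesis
      by auto
  qed
  have adj: "s (nxt e) \<noteq> Some (\<not> d)" if "e < n" "s e = Some d" for e d
  proof -
    consider "Suc e < n" "Suc e \<noteq> k" | "e = n - 1" | "Suc e = k"
      using \<open>e < n\<close> by linarith
    then show ?thesis
    proof cases
      case 1
      then show ?thesis
        using consistentD(1)[OF c 1] that by (auto simp: nxt_def)
    next
      \<comment> \<open>Here the edge and its successor meet at a chord end. Of the two sign
        changes, one would make both end edges aligned, against consistency, and the other neither,
        against \<open>settled\<close>.\<close>
      case 2
      then show ?thesis
        using settled[of True] consistentD(2)[OF c, of True True] that n_ge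
        by (auto simp: settled_def ex_bool_eq end_edge_def nxt_def)
    next
      case 3
      then show ?thesis
        using settled[of False] consistentD(2)[OF c, of True False] that n_ge
        by (auto simp: settled_def ex_bool_eq end_edge_def nxt_def)
    qed
  qed
  \<comment> \<open>\<open>run_parity\<close> has to start at a marked edge. The settled chord end 0
    supplies one, and the cycle is cut open there.\<close>
  have "s 0 = Some True \<or> s (n - 1) = Some False"
    using settled[of True] by (auto simp: settled_def ex_bool_eq end_edge_def)
  then have "even (card {e. e < n \<and> s e = None})"
  proof
    assume 0: "s 0 = Some True"
    define f where "f i = (if i = n then s 0 else s i)" for i
    have "even (card {i. i < n \<and> f i = None}) \<longleftrightarrow> True = True"
    proof (rule run_parity[where N = n and f = f])
      show "f (Suc i) \<noteq> Some (\<not> d)" if "i < n" "f i = Some d" for i d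
        using adj[of i d] that by (cases "Suc i = n") (auto simp: f_def nxt_def)
      show "\<exists>d. f i = Some d \<and> f (Suc (Suc i)) = Some (\<not> d)" if "Suc i < n" "f (Suc i) = None" for i
        using gap[of "Suc i"] that by (auto simp: f_def nxt_def prv_def split: if_splits)
    qed (use 0 in \<open>auto simp: f_def\<close>)
    moreover have "{i. i < n \<and> f i = None} = {e. e < n \<and> s e = None}"
      by (auto simp: f_def)
    ultimately show ?thesis
      by simp
  next
    assume l: "s (n - 1) = Some False"
    \<comment> \<open>The cycle is listed from edge \<open>n - 1\<close> on, so indices shift by one
      and index \<open>n\<close> repeats index 0.\<close>
    define f where "f i = (if i = 0 then s (n - 1) else s (i - 1))" for i
    have "even (card {i. i < n \<and> f i = None}) \<longleftrightarrow> False = False"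
    proof (rule run_parity[where N = n and f = f])
      show "f (Suc i) \<noteq> Some (\<not> d)" if "i < n" "f i = Some d" for i d
        using adj[of "prv i" d] that by (auto simp: f_def nxt_def prv_def split: if_splits)
      show "\<exists>d. f i = Some d \<and> f (Suc (Suc i)) = Some (\<not> d)" if "Suc i < n" "f (Suc i) = None" for i
        using gap[of i] that by (auto simp: f_def nxt_def prv_def)
    qed (use l n_ge in \<open>auto simp: f_def\<close>)
    moreover have "{i. i < n \<and> f i = None} = Suc ` {e. e < n \<and> s e = None}" (is "?X = ?Y")
    proof
      show "?X \<subseteq> ?Y"
      proof
        fix i
        assume "i \<in> ?X"
        then show "i \<in> ?Y"
          using l by (cases i) (auto simp: f_def)
      qed
      have "Suc e < n" if "e < n" "s e = None" for e
        using that l by (cases "e = n - 1") auto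
      then show "?Y \<subseteq> ?X"
        by (auto simp: f_def)
    qed
    ultimately show ?thesis
      by (simp add: card_image)
  qed
  then show ?thesis
    using chord by (simp add: unmarked_B)
qed

section \<open>Threats to complete a path\<close>

lemma not_nearly_full_if_no_opposed:
  assumes "\<And>e. e < n \<Longrightarrow> (e < k) = z \<Longrightarrow> s e \<noteq> Some (\<not> z)"
  shows "\<not> nearly_full z s"
proof
  assume "nearly_full z s"
  then obtain f where f: "full z (s(f := Some (\<not> z)))"
    by (auto simp: nearly_full_def)
  \<comment> \<open>The path has two distinct end edges, so one of them differs from the missing
    edge and must be opposed.\<close>
  obtain v where "end_edge z v \<noteq> f"
    using end_edge_props(3) by metis
  then have "s (end_edge z v) = Some (\<not> z)"
    using f by (auto simp: full_def dest!: spec[of _ "end_edge z v"])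
  then show False
    using assms[of "end_edge z v"] by simp
qed

text \<open>Only an opposed arrow can make a new threat on its path. Hence aligned arrows, in
  particular those that settle a chord end, are always safe.\<close>

lemma new_threat:
  assumes "nearly_full z (s(e := Some d))" "\<not> nearly_full z s" "s e = None" "e < n"
  obtains f where "(e < k) = z" "d = (\<not> z)" "f < n" "(f < k) = z" "f \<noteq> e" "s f = None"
    "full z (s(e := Some (\<not> z), f := Some (\<not> z)))"
proof -
  obtain f where f: "f < n" "(f < k) = z" "(s(e := Some d)) f \<noteq> Some z"
      "full z (s(e := Some d, f := Some (\<not> z)))"
    using assms(1) unfolding nearly_full_def by blast
  have e: "(e < k) = z"
  proof (rule ccontr)
    assume "(e < k) \<noteq> z"
    then have "nearly_full z s"
      using f by (auto simp: nearly_full_def full_def split: if_splits)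
    then show False
      using assms(2) by simp
  qed
  have fe: "f \<noteq> e"
  proof
    assume "f = e"
    then have "nearly_full z s"
      using f e assms by (auto simp: nearly_full_def)
    then show False
      using assms(2) by simp
  qed
  then have d: "d = (\<not> z)"
    using f(4) e assms(4) by (auto simp: full_def dest!: spec[of _ e])
  have "s f \<noteq> Some (\<not> z)"
  proof
    assume "s f = Some (\<not> z)"
    then have "s(e := Some d, f := Some (\<not> z)) = s(e := Some d)"
      using fe by auto
    then have "nearly_full z s"
      using f e assms d by (auto simp: nearly_full_def)
    then show False
      using assms(2) by simp
  qed
  then have "s f = None"
    using f(3) fe by (cases "s f") auto
  then show thesis
    using that[OF e d f(1,2) fe] f(4) d by simp
qed

lemma not_full_after_move:
  assumes "\<And>z. \<not> nearly_full z s" "s n = Some True" "legal_move B s e d"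
  shows "\<not> full z (s(e := Some d))"
proof
  assume full: "full z (s(e := Some d))"
  have e: "e < n" "s e = None"
    using assms by (auto simp: legal_iff)
  have "nearly_full z s"
  proof (cases "(e < k) = z")
    case True
    then have "d = (\<not> z)"
      using full e by (auto simp: full_def dest!: spec[of _ e])
    then show ?thesis
      using full e True by (auto simp: nearly_full_def)
  next
    case False
    then have "full z s"
      using full by (auto simp: full_def split: if_splits)
    then show ?thesis
      unfolding nearly_full_def
      by (intro exI[of _ "end_edge z True"]) (auto simp: full_def)
  qed
  then show False
    using assms(1) by simp
qed

text \<open>By \<open>consistent_full\<close> the sink-source rule never blocks the arrow that
  completes a path.\<close>

lemma completing_reply:
  assumes "s n = Some True" "consistent s" "nearly_full z s" "\<not> full z s"
  shows "reply B P s"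
proof -
  obtain e where e: "e < n" "(e < k) = z" "s e \<noteq> Some z" "full z (s(e := Some (\<not> z)))"
    using assms(3) by (auto simp: nearly_full_def)
  have "s e \<noteq> Some (\<not> z)"
  proof
    assume "s e = Some (\<not> z)"
    then have "s(e := Some (\<not> z)) = s"
      by auto
    then show False
      using e assms(4) by simp
  qed
  then have "s e = None"
    using e(3) by (cases "s e") auto
  moreover have "consistent (s(e := Some (\<not> z)))"
    using e by (intro consistent_full[OF assms(2) e(4)]) auto
  moreover have "has_cycle_cell B (s(e := Some (\<not> z)))"
    using e assms(1) by (subst has_cycle_cell_B) auto
  ultimately show ?thesis
    using e assms(1) unfolding reply_def by (auto simp: legal_iff)
qed

text \<open>Holds with the opponent to move. By \<open>terminal_even\<close> play can be blocked
  only at an even count, that is, on the opponent's turn.\<close>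

definition secure :: "position \<Rightarrow> bool" where
  "secure s \<longleftrightarrow> s n = Some True \<and> consistent s \<and> (\<forall>v. settled v s) \<and>
     even (unmarked B s) \<and> (\<forall>z. \<not> nearly_full z s)"

lemma settled_mono: "settled v s \<Longrightarrow> s e = None \<Longrightarrow> settled v (s(e := Some d))"
  unfolding settled_def by (metis fun_upd_other option.distinct(1))

text \<open>Suppose that every legal move makes a threat. Filling in one threatened path marks two
  edges, so the count stays odd and a further move exists, necessarily on the other path. It makes a
  threat there, so both paths would be opposed at chord end 0, which is settled.\<close>

lemma settled_reply:
  assumes chord: "s n = Some True" and c: "consistent s" and settled: "\<And>v. settled v s"
    and odd: "odd (unmarked B s)" and nf: "\<And>z. \<not> full z s"
  shows "reply B secure s"
proof (rule ccontr)
  assume no: "\<not> reply B secure s"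
  have nn: "\<not> nearly_full z s" for z
    using completing_reply[OF chord c _ nf] no by blast
  have threat: "\<exists>f. d = (\<not> (e < k)) \<and> f < n \<and> (f < k) = (e < k) \<and> f \<noteq> e \<and> s f = None \<and>
      full (e < k) (s(e := Some d, f := Some d))"
    if l: "legal_move B s e d" for e d
  proof -
    have e: "e < n" "s e = None" "consistent (s(e := Some d))"
      using l chord by (auto simp: legal_iff)
    have "\<not> secure (s(e := Some d))"
      using no l by (auto simp: reply_def)
    moreover have "even (unmarked B (s(e := Some d)))"
      using unmarked_move[OF _ l] odd by simp
    ultimately obtain z where z: "nearly_full z (s(e := Some d))"
      using e chord settled settled_mono by (auto simp: secure_def)
    then show ?thesis
      by (rule new_threat[OF _ nn e(2,1)]) auto
  qed
  obtain e d where l: "legal_move B s e d"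
    using terminal_even[OF chord c settled] odd by blast
  define z where "z = (e < k)"
  obtain f where f: "d = (\<not> z)" "f < n" "(f < k) = z" "f \<noteq> e" "s f = None"
      "full z (s(e := Some d, f := Some d))"
    using threat[OF l] z_def by blast
  \<comment> \<open>\<open>u\<close> is not played: it is the position with the threatened path
    filled in.\<close>
  define u where "u = s(e := Some d, f := Some d)"
  have e: "e < n" "s e = None"
    using l chord by (auto simp: legal_iff)
  have u_n: "u n = Some True"
    using chord e f by (auto simp: u_def)
  have u_c: "consistent u"
    using f z_def by (intro consistent_full[OF c f(6)[folded u_def]]) (auto simp: u_def)
  have u_s: "settled v u" for v
    unfolding u_def using settled e f by (intro settled_mono) auto
  have "legal_move B (s(e := Some d)) f d"
    using u_c chord e f by (subst legal_iff) (auto simp: u_def)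
  then have "odd (unmarked B u)"
    using unmarked_move[OF _ l] unmarked_move[of B "s(e := Some d)" f d] odd by (simp add: u_def)
  then obtain g d' where g: "legal_move B u g d'"
    using terminal_even[OF u_n u_c u_s] by blast
  then have g': "g < n" "u g = None" "no_sink_source B (u(g := Some d'))"
    using u_n legal_iff[of u g d'] by (auto simp: legal_move_def)
  have gz: "(g < k) \<noteq> z"
    using g' f(6)[folded u_def] by (auto simp: full_def)
  have "g \<noteq> e" "g \<noteq> f"
    using gz f z_def by auto
  then have "s g = None"
    using g' by (auto simp: u_def)
  \<comment> \<open>Erasing the two imagined arrows keeps the move at \<open>g\<close> legal, so it
    is a threat in \<open>s\<close> as well.\<close>
  have "s(g := Some d') \<subseteq>\<^sub>m u(g := Some d')"
    using e f by (auto simp: map_le_def u_def)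
  then have "legal_move B s g d'"
    using no_sink_source_antimono[OF _ g'(3)] g' \<open>s g = None\<close> by (auto simp: legal_move_def)
  then obtain f' where f': "f' \<noteq> g" "s f' = None" "d' = z"
      "full (\<not> z) (s(g := Some d', f' := Some d'))"
    using threat[of g d'] gz by fastforce
  \<comment> \<open>Path \<open>z\<close> is opposed at chord end 0 in \<open>u\<close>, so the
    aligned end edge there lies on the other path; it is present in \<open>s\<close>
    already.\<close>
  have "u (end_edge z True) = Some (\<not> z)"
    using f(6)[folded u_def] by (simp add: full_def)
  then have "u (end_edge (\<not> z) True) = Some (\<not> z)"
    using u_s[of True] by (auto simp: settled_def) (metis (full_types) option.inject)
  then have end_edge: "s (end_edge (\<not> z) True) = Some (\<not> z)"
    using f z_def by (auto simp: u_def split: if_splits)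
  then have "(s(g := Some d', f' := Some d')) (end_edge (\<not> z) True) = Some (\<not> z)"
    using \<open>s g = None\<close> f' by auto
  then show False
    using f'(4) unfolding full_def by (metis end_edge_props(1,2) option.inject)
qed

lemma secure_lost:
  assumes "secure s"
  shows "lost B s"
proof (rule lost_invariant[where I = secure, OF assms])
  fix s e d
  assume s: "secure s" and l: "legal_move B s e d"
  let ?t = "s(e := Some d)"
  have chord: "s n = Some True" and nn: "\<And>z. \<not> nearly_full z s"
    using s by (auto simp: secure_def)
  have e: "e < n" "s e = None" "consistent ?t"
    using l chord by (auto simp: legal_iff)
  have nf: "\<not> full z ?t" for z
    using not_full_after_move[OF nn chord l] .
  have t_n: "?t n = Some True"
    using chord e by simp
  have "reply B secure ?t"
  proof (rule settled_reply[OF t_n e(3)])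
    show "odd (unmarked B ?t)"
      using unmarked_move[OF _ l] s by (auto simp: secure_def)
    show "settled v ?t" for v
      using s e settled_mono by (auto simp: secure_def)
  qed (rule nf)
  then have "reply B (\<lambda>t. secure t \<or> lost B t) ?t"
    by (rule reply_mono) simp
  then show "\<not> has_cycle_cell B ?t \<and> reply B (\<lambda>t. secure t \<or> lost B t) ?t"
    using nf by (simp only: has_cycle_cell_B[of ?t] t_n) simp
qed

section \<open>Settling the chord ends\<close>

lemma settle_legal:
  assumes chord: "s n = Some True" and c: "consistent s" and none: "s (end_edge z v) = None"
    and second_edge: "s (second_edge z v) \<noteq> Some (\<not> z)" and other: "s (end_edge (\<not> z) v) \<noteq> Some (\<not> z)"
  shows "legal_move B s (end_edge z v) z"
proof -
  have "consistent (s(end_edge z v := Some z))"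
  proof (rule ccontr)
    assume "\<not> consistent (s(end_edge z v := Some z))"
    from c none this show False
    proof (cases rule: conflict)
      case (1 i)
      then have "i = second_edge z v"
        using k_ge n_ge by (cases z; cases v) (auto simp: end_edge_def second_edge_def)
      then show False
        using 1 second_edge by simp
    next
      case 2
      then have "Suc (end_edge z v) = second_edge z v"
        using k_ge n_ge by (cases z; cases v) (auto simp: end_edge_def second_edge_def)
      then show False
        using 2 second_edge by simp
    next
      case (3 v')
      then show False
        using other by simp
    qed
  qed
  then show ?thesis
    using chord none by (simp add: legal_iff)
qed

text \<open>The opponent, to move, cannot prevent an aligned end edge at the chord end not yet
  settled: one move spoils at most one of the two paths there.\<close>

definition half_secure :: "bool \<Rightarrow> position \<Rightarrow> bool" where
  "half_secure v s \<longleftrightarrow> s n = Some True \<and> consistent s \<and> settled v s \<and>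
     even (unmarked B s) \<and> (\<forall>z. \<not> nearly_full z s) \<and>
     (\<forall>z. s (end_edge z (\<not> v)) \<noteq> Some (\<not> z) \<and> s (second_edge z (\<not> v)) \<noteq> Some (\<not> z))"

lemma half_secure_lost:
  assumes s: "half_secure v s"
  shows "lost B s"
proof (rule lost_if_reply)
  fix e d
  assume l: "legal_move B s e d"
  let ?t = "s(e := Some d)"
  have chord: "s n = Some True" and nn: "\<And>z. \<not> nearly_full z s" and sv: "settled v s"
    using s by (auto simp: half_secure_def)
  have e: "e < n" "s e = None" "consistent ?t"
    using l chord by (auto simp: legal_iff)
  have nf: "\<not> full z ?t" for z
    using not_full_after_move[OF nn chord l] .
  have t_n: "?t n = Some True"
    using chord e by simp
  have t_odd: "odd (unmarked B ?t)"
    using unmarked_move[OF _ l] s by (auto simp: half_secure_def)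
  have t_v: "settled v ?t"
    using sv e settled_mono by blast
  have "reply B (lost B) ?t"
  proof (cases "\<exists>z. nearly_full z ?t")
    case True
    then show ?thesis
      using completing_reply[OF t_n e(3) _ nf] by blast
  next
    case no_threat: False
    show ?thesis
    proof (cases "settled (\<not> v) ?t")
      case True
      then have "settled w ?t" for w
        using t_v by (cases "w = v") auto
      from settled_reply[OF t_n e(3) this t_odd nf] show ?thesis
        by (rule reply_mono) (rule secure_lost)
    next
      case False
      \<comment> \<open>The path that the opponent's move did not touch; its end edge at the open
        chord end is still available.\<close>
      define z where "z = (\<not> e < k)"
      let ?w = "\<not> v"
      have ne: "e \<noteq> end_edge z ?w" "e \<noteq> second_edge z ?w"
        using end_edge_props(2)[of z ?w] second_edge_props(2)[of z ?w] unfolding z_def by metis+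
      have u: "?t (end_edge z ?w) \<noteq> Some z" "?t (end_edge (\<not> z) ?w) \<noteq> Some (\<not> z)"
        using False unfolding settled_def by blast+
      have "?t (end_edge z ?w) = None"
        using s ne u(1) by (cases "s (end_edge z ?w)") (auto simp: half_secure_def)
      moreover have "?t (second_edge z ?w) \<noteq> Some (\<not> z)"
        using s ne by (auto simp: half_secure_def)
      ultimately have l': "legal_move B ?t (end_edge z ?w) z"
        using settle_legal[OF t_n e(3)] u(2) by blast
      let ?u = "?t(end_edge z ?w := Some z)"
      have none: "?t (end_edge z ?w) = None" "consistent ?u"
        using l' t_n by (auto simp: legal_iff)
      have "settled ?w ?u"
        unfolding settled_def by (intro exI[of _ z]) simp
      moreover have "settled v ?u"
        using t_v none(1) by (rule settled_mono)
      ultimately have "settled w ?u" for w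
        by (cases "w = v") auto
      moreover have "\<not> nearly_full y ?u" for y
      proof
        assume "nearly_full y ?u"
        moreover have "\<not> nearly_full y ?t"
          using no_threat by blast
        ultimately show False
          using none(1) by (rule new_threat) auto
      qed
      moreover have "even (unmarked B ?u)"
        using unmarked_move[OF _ l'] t_odd by simp
      moreover have "?u n = Some True"
        using t_n end_edge_props(1)[of z ?w] by (metis fun_upd_other less_irrefl)
      ultimately have "secure ?u"
        using none(2) unfolding secure_def by blast
      then show ?thesis
        using l' secure_lost unfolding reply_def by blast
    qed
  qed
  then show "\<not> has_cycle_cell B ?t \<and> reply B (lost B) ?t"
    using nf by (simp only: has_cycle_cell_B[of ?t] t_n) simp
qed

section \<open>Reflection strategy\<close>

text \<open>The reflection exchanging 0 and \<open>k\<close> reverses the chord and the reference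
  directions. Followed by arrow reversal it fixes the chord and carries marks over
  unchanged.\<close>

definition mirror :: "nat \<Rightarrow> nat" where
  "mirror e = (if e < k then k - 1 - e else n + k - 1 - e)"

lemma mirror_props:
  assumes "e < n"
  shows "mirror e < n" "mirror e < k \<longleftrightarrow> e < k" "mirror (mirror e) = e"
  using assms k_ge n_ge by (auto simp: mirror_def)

lemma mirror_end_edge [simp]: "mirror (end_edge z v) = end_edge z (\<not> v)"
  using k_ge n_ge by (auto simp: mirror_def end_edge_def)

lemma mirror_Suc:
  assumes "Suc i < n" "Suc i \<noteq> k"
  shows "Suc (mirror (Suc i)) = mirror i" "mirror (Suc i) \<noteq> k - 1"
  using assms k_ge n_ge by (auto simp: mirror_def)

text \<open>The middle edge of a path of odd length is its own image and must already be marked, so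
  that every move of the opponent has a distinct unmarked image.\<close>

definition mirrored :: "position \<Rightarrow> bool" where
  "mirrored s \<longleftrightarrow> s n = Some True \<and> consistent s \<and> (\<forall>z. \<not> full z s) \<and>
     (\<forall>e<n. s (mirror e) = s e) \<and> (\<forall>e<n. mirror e = e \<longrightarrow> s e \<noteq> None)"

text \<open>An arrow vetoing the copy carries \<open>\<not> d\<close>, hence was there before, and
  its mirror image would have vetoed the opponent's move.\<close>

lemma mirror_consistent:
  assumes c: "consistent (s(e := Some d))" and e: "e < n" "s e = None" "mirror e \<noteq> e"
    and sym: "\<And>e. e < n \<Longrightarrow> s (mirror e) = s e"
  shows "consistent (s(e := Some d, mirror e := Some d))"
proof (rule ccontr)
  let ?t = "s(e := Some d)"
  assume bad: "\<not> consistent (?t(mirror e := Some d))"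
  have none: "?t (mirror e) = None"
    using e sym by simp
  have mm: "mirror (mirror e) = e"
    using mirror_props(3) e by blast
  have image: "?t (mirror i) = Some (\<not> d)" if "i < n" "?t i = Some (\<not> d)" for i
  proof -
    have "i \<noteq> e" "s i = Some (\<not> d)"
      using that by (auto split: if_splits)
    moreover have "mirror i \<noteq> e"
    proof
      assume "mirror i = e"
      then have "i = mirror e"
        using mirror_props(3)[OF that(1)] by simp
      then show False
        using that none by simp
    qed
    ultimately show ?thesis
      using sym[OF that(1)] by simp
  qed
  from c none bad show False
  proof (cases rule: conflict)
    case (1 i)
    have "Suc e = mirror i" "e \<noteq> k - 1"
      using mirror_Suc[OF 1(1,2)] mm 1(3) by auto
    moreover have "?t (mirror i) = Some (\<not> d)"
      using image 1 by simp
    moreover have "mirror i < n"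
      using mirror_props(1)[of i] 1 by simp
    ultimately have "Suc e < n" "Suc e \<noteq> k" "?t (Suc e) = Some (\<not> d)"
      by auto
    then show False
      using consistentD(1)[OF c, of e d] by simp
  next
    case 2
    have "Suc (mirror (Suc (mirror e))) = e"
      using mirror_Suc(1)[OF 2(1,2)] mm by simp
    moreover have "?t (mirror (Suc (mirror e))) = Some (\<not> d)"
      using image 2 by simp
    moreover have "e \<noteq> k"
    proof
      assume "e = k"
      then show False
        using 2 n_ge by (auto simp: mirror_def)
    qed
    ultimately show False
      using consistentD(1)[OF c, of "mirror (Suc (mirror e))" "\<not> d"] e by simp
  next
    case (3 v)
    have "e = end_edge d (\<not> v)"
      using mm 3(1) by (metis mirror_end_edge)
    moreover have "?t (end_edge (\<not> d) (\<not> v)) = Some (\<not> d)"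
      using image[OF _ 3(2)] by simp
    ultimately show False
      using consistentD(2)[OF c, of d "\<not> v"] by simp
  qed
qed

lemma mirrored_lost:
  assumes "mirrored s"
  shows "lost B s"
proof (rule lost_invariant[where I = mirrored, OF assms])
  fix s e d
  assume s: "mirrored s" and l: "legal_move B s e d"
  let ?t = "s(e := Some d)"
  let ?u = "?t(mirror e := Some d)"
  have chord: "s n = Some True" and sym: "\<And>e. e < n \<Longrightarrow> s (mirror e) = s e" and nf: "\<And>z. \<not> full z s"
    and mid: "\<And>e. e < n \<Longrightarrow> mirror e = e \<Longrightarrow> s e \<noteq> None"
    using s by (auto simp: mirrored_def)
  have e: "e < n" "s e = None" "consistent ?t"
    using l chord by (auto simp: legal_iff)
  have me: "mirror e \<noteq> e" "s (mirror e) = None"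
    using mid[OF e(1)] sym[OF e(1)] e(2) by auto
  have t_n: "?t n = Some True"
    using chord e by simp
  \<comment> \<open>The opponent cannot complete the path of \<open>e\<close>, because
    \<open>mirror e\<close> on the same path is still unmarked.\<close>
  have nf': "\<not> full z ?t" for z
  proof
    assume full: "full z ?t"
    show False
    proof (cases "(e < k) = z")
      case True
      then have "?t (mirror e) = Some (\<not> z)"
        using full mirror_props(1,2)[OF e(1)] by (auto simp: full_def)
      then show False
        using me by simp
    next
      case False
      then have "full z s"
        using full by (auto simp: full_def split: if_splits)
      then show False
        using nf by simp
    qed
  qed
  have u_c: "consistent ?u"
    using mirror_consistent[OF e(3,1,2) me(1) sym] .
  have u_n: "?u n = Some True"
    using t_n mirror_props(1)[OF e(1)] by simp
  have l': "legal_move B ?t (mirror e) d"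
    using u_c me mirror_props(1)[OF e(1)] t_n by (simp add: legal_iff)
  have "has_cycle_cell B ?u \<or> mirrored ?u"
  proof (cases "\<exists>z. full z ?u")
    case True
    then show ?thesis
      using u_n by (simp add: has_cycle_cell_B)
  next
    case False
    have "?u (mirror f) = ?u f" if f: "f < n" for f
    proof -
      have "mirror f = e \<longleftrightarrow> f = mirror e" "mirror f = mirror e \<longleftrightarrow> f = e"
        using mirror_props(3) f e(1) by metis+
      then show ?thesis
        using sym[OF f] me mirror_props(3)[OF e(1)] by simp
    qed
    moreover have "?u f \<noteq> None" if "f < n" "mirror f = f" for f
      using mid that by simp
    ultimately show ?thesis
      using False u_c u_n by (simp add: mirrored_def)
  qed
  then have "reply B (\<lambda>t. mirrored t \<or> lost B t) ?t"
    using l' unfolding reply_def by blast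
  then show "\<not> has_cycle_cell B ?t \<and> reply B (\<lambda>t. mirrored t \<or> lost B t) ?t"
    using nf' by (simp only: has_cycle_cell_B[of ?t] t_n) simp
qed

section \<open>Positions with at most one arrow besides the chord\<close>

lemma consistent_if_uniform:
  assumes "\<And>e f. e < n \<Longrightarrow> f < n \<Longrightarrow> (e < k) = (f < k) \<Longrightarrow> s e \<noteq> None \<Longrightarrow> s f \<noteq> None \<Longrightarrow> s e = s f"
    and "\<And>v. \<exists>z. s (end_edge z v) \<noteq> Some z"
  shows "consistent s"
proof -
  have "s (Suc i) \<noteq> Some (\<not> d)" if "Suc i < n" "Suc i \<noteq> k" "s i = Some d" for i d
  proof
    assume "s (Suc i) = Some (\<not> d)"
    moreover have "(i < k) = (Suc i < k)"
      using that by auto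
    ultimately show False
      using assms(1)[of i "Suc i"] that by simp
  qed
  moreover have "\<not> (s (end_edge True v) = Some True \<and> s (end_edge False v) = Some False)" for v
    using assms(2)[of v] by (auto simp: ex_bool_eq)
  ultimately show ?thesis
    unfolding consistent_def by blast
qed

text \<open>By parity this is either the chord alone with \<open>n\<close> even, or the chord and
  one aligned arrow away from the chord ends with \<open>n\<close> odd.\<close>

definition fresh :: "position \<Rightarrow> bool" where
  "fresh s \<longleftrightarrow> s n = Some True \<and> even (unmarked B s) \<and>
     (\<forall>e<n. s e \<noteq> None \<longrightarrow> s e = Some (e < k) \<and> (\<forall>z v. e \<noteq> end_edge z v)) \<and>
     (\<forall>e<n. \<forall>f<n. s e \<noteq> None \<longrightarrow> s f \<noteq> None \<longrightarrow> e = f)"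

lemma fresh_consistent:
  assumes "fresh s"
  shows "consistent s"
proof (rule consistent_if_uniform)
  show "s e = s f" if "e < n" "f < n" "s e \<noteq> None" "s f \<noteq> None" for e f
    using assms that unfolding fresh_def by metis
  show "\<exists>z. s (end_edge z v) \<noteq> Some z" for v
    using assms unfolding fresh_def by (metis end_edge_props(1) option.distinct(1))
qed

lemma half_secure_reply:
  assumes chord: "t n = Some True" and c: "consistent t" and odd: "odd (unmarked B t)"
    and nt: "\<And>y. \<not> nearly_full y t"
    and none: "t (end_edge z v) = None" and second_edge: "t (second_edge z v) \<noteq> Some (\<not> z)" and other: "t (end_edge (\<not> z) v) \<noteq> Some (\<not> z)"
    and free: "\<And>y. t (end_edge y (\<not> v)) \<noteq> Some (\<not> y) \<and> t (second_edge y (\<not> v)) \<noteq> Some (\<not> y)"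
  shows "reply B (lost B) t"
proof -
  have l: "legal_move B t (end_edge z v) z"
    using settle_legal[OF chord c none second_edge other] .
  let ?u = "t(end_edge z v := Some z)"
  have c': "consistent ?u"
    using l chord by (simp add: legal_iff)
  have "\<not> nearly_full y ?u" for y
  proof
    assume "nearly_full y ?u"
    then show False
      using nt none by (rule new_threat) auto
  qed
  moreover have "settled v ?u"
    unfolding settled_def by (intro exI[of _ z]) simp
  moreover have "even (unmarked B ?u)"
    using unmarked_move[OF _ l] odd by simp
  moreover have "?u n = Some True"
    using chord end_edge_props(1)[of z v] by (metis fun_upd_other less_irrefl)
  moreover have "?u f \<noteq> Some (\<not> y)" if "t f \<noteq> Some (\<not> y)" "f < k \<longleftrightarrow> y" for f y
    using that by auto
  then have "?u (end_edge y (\<not> v)) \<noteq> Some (\<not> y) \<and> ?u (second_edge y (\<not> v)) \<noteq> Some (\<not> y)" for y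
    using free[of y] by (metis end_edge_props(2) second_edge_props(2))
  ultimately have "half_secure v ?u"
    using c' unfolding half_secure_def by blast
  then show ?thesis
    using l half_secure_lost unfolding reply_def by blast
qed

text \<open>An aligned move leaves nothing opposed, so a chord end can be settled at once. After an
  opposed move a threat is completed, or a chord end is settled while the other stays unspoilt. What
  remains is an opposed middle edge of a path of length 3, spoiling both ends; it is met by
  reflection.\<close>

lemma fresh_lost:
  assumes s: "fresh s"
  shows "lost B s"
proof (rule lost_if_reply)
  fix e d
  assume l: "legal_move B s e d"
  let ?t = "s(e := Some d)"
  have chord: "s n = Some True" and s_even: "even (unmarked B s)"
    and val: "\<And>f. f < n \<Longrightarrow> s f \<noteq> None \<Longrightarrow> s f = Some (f < k)"
    and s_end: "\<And>z v. s (end_edge z v) = None"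
    and one: "\<And>f g. f < n \<Longrightarrow> g < n \<Longrightarrow> s f \<noteq> None \<Longrightarrow> s g \<noteq> None \<Longrightarrow> f = g"
    using s unfolding fresh_def by (blast, blast, blast, metis end_edge_props(1), blast)
  have e: "e < n" "s e = None" "consistent ?t"
    using l chord by (auto simp: legal_iff)
  have s_C: "s f \<noteq> Some (\<not> z)" if "f < n" "(f < k) = z" for f z
    using val[OF that(1)] that(2) by (cases "s f") auto
  have nn: "\<not> nearly_full z s" for z
    using s_C by (intro not_nearly_full_if_no_opposed)
  have nf: "\<not> full z ?t" for z
    using not_full_after_move[OF nn chord l] .
  have t_n: "?t n = Some True"
    using chord e by simp
  have t_odd: "odd (unmarked B ?t)"
    using unmarked_move[OF _ l] s_even by simp
  define z where "z = (e < k)"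
  have "reply B (lost B) ?t"
  proof (cases "d = z")
    case True
    have t_C: "?t f \<noteq> Some (\<not> y)" if "f < n" "(f < k) = y" for f y
      using s_C[OF that] True that by (auto simp: z_def)
    obtain w where w: "e \<noteq> end_edge z w"
      using end_edge_props(3) by metis
    show ?thesis
    proof (rule half_secure_reply[OF t_n e(3) t_odd, of z w])
      show "\<not> nearly_full y ?t" for y
        using t_C by (intro not_nearly_full_if_no_opposed)
      have "e \<noteq> end_edge (\<not> z) w"
        using end_edge_props(2)[of "\<not> z" w] unfolding z_def by metis
      then show "?t (end_edge (\<not> z) w) \<noteq> Some (\<not> z)"
        using s_end by simp
    qed (use w s_end t_C[of "second_edge z w" z] t_C[of "end_edge _ _"] t_C[of "second_edge _ _"] in \<open>simp_all\<close>)
  next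
    case d: False
    then have d: "d = (\<not> z)"
      by simp
    have t_z: "?t f \<noteq> Some (\<not> y)" if "f < n" "(f < k) = y" "f \<noteq> e" for f y
      using s_C[OF that(1,2)] that by simp
    show ?thesis
    proof (cases "\<exists>y. nearly_full y ?t")
      case True
      then show ?thesis
        using completing_reply[OF t_n e(3) _ nf] by blast
    next
      case no_threat: False
      have other: "e \<noteq> end_edge (\<not> z) v" "e \<noteq> second_edge (\<not> z) v" for v
        using end_edge_props(2)[of "\<not> z" v] second_edge_props(2)[of "\<not> z" v] unfolding z_def by metis+
      show ?thesis
      proof (cases "e = second_edge z True \<and> e = second_edge z False")
        case False
        \<comment> \<open>Otherwise \<open>e\<close> is the end edge at one chord end and the second
          edge at the other. Its path then has length 2, and the opposed arrow is already a
          threat.\<close>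
        have "\<exists>w. e \<noteq> end_edge z w \<and> e \<noteq> second_edge z w"
        proof (rule ccontr)
          assume "\<not> ?thesis"
          then obtain v where v: "e = end_edge z v" "e = second_edge z (\<not> v)"
            using False by (metis (full_types) end_edge_props(3))
          have "end_edge z v = second_edge z (\<not> v)"
            using v by simp
          then have "if z then k = 2 else n = k + 2"
            using k_ge n_ge unfolding end_edge_def second_edge_def by (cases z; cases v) auto
          then have "f = end_edge z v \<or> f = end_edge z (\<not> v)" if "f < n" "(f < k) = z" for f
            using that unfolding end_edge_def by (cases z; cases v) auto
          then have "f = e \<or> f = end_edge z (\<not> v)" if "f < n" "(f < k) = z" for f
            using that v(1) by simp
          then have "full z (?t(end_edge z (\<not> v) := Some (\<not> z)))"
            using d by (auto simp: full_def)
          then have "nearly_full z ?t"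
            unfolding nearly_full_def using v s_end[of z "\<not> v"]
            by (intro exI[of _ "end_edge z (\<not> v)"]) auto
          then show False
            using no_threat by blast
        qed
        then obtain w where w: "e \<noteq> end_edge z w" "e \<noteq> second_edge z w"
          by blast
        show ?thesis
        \<comment> \<open>Chord end \<open>w\<close> is not spoilt by \<open>e\<close> and can wait;
          the other one is settled on the path avoiding \<open>e\<close>.\<close>
        proof (rule half_secure_reply[OF t_n e(3) t_odd, of "\<not> z" "\<not> w"])
          show "\<not> nearly_full y ?t" for y
            using no_threat by blast
          show "?t (end_edge (\<not> z) (\<not> w)) = None"
            using s_end by (simp add: other[symmetric])
          show "?t (second_edge (\<not> z) (\<not> w)) \<noteq> Some (\<not> \<not> z)"
            by (intro t_z) (simp_all add: other[symmetric])
          show "?t (end_edge (\<not> \<not> z) (\<not> w)) \<noteq> Some (\<not> \<not> z)"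
            using d s_end by simp
          have "e \<noteq> end_edge y w \<and> e \<noteq> second_edge y w" for y
            using w other by (cases "y = z") auto
          then show "?t (end_edge y (\<not> \<not> w)) \<noteq> Some (\<not> y) \<and> ?t (second_edge y (\<not> \<not> w)) \<noteq> Some (\<not> y)" for y
            using t_z[of "end_edge y w" y] t_z[of "second_edge y w" y] by auto
        qed
      next
        case True
        have e_end: "e \<noteq> end_edge y v" for y v
          using True other second_edge_props(3) by (metis (full_types))
        have len: "if z then k = 3 \<and> e = 1 else n = k + 3 \<and> e = k + 1"
          using True k_ge n_ge by (auto simp: second_edge_def split: if_splits)
        have mirror_e: "mirror e = e"
          using len n_ge unfolding mirror_def by (cases z) auto
        have strip_z: "f = e \<or> (\<exists>v. f = end_edge z v)" if "f < n" "(f < k) = z" for f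
        proof -
          have "f = e \<or> f = end_edge z True \<or> f = end_edge z False"
            using that len n_ge unfolding end_edge_def by (cases z) auto
          then show ?thesis
            by blast
        qed
        have s_z: "s f = None" if "f < n" "(f < k) = z" for f
          using strip_z[OF that] e s_end by auto
        have fixed: "f = e" if "f < n" "(f < k) = z" "mirror f = f" for f
          using strip_z[OF that(1,2)] that(3) by auto
        \<comment> \<open>The reply \<open>h\<close> is an aligned arrow on the other path, which
          has \<open>n - 3\<close> edges. For odd \<open>n\<close> it is the mirror image of the
          arrow already there; for even \<open>n\<close> it is the middle edge.\<close>
        have "\<exists>h<n. (h < k) = (\<not> z) \<and> s h = None \<and> (\<forall>v. h \<noteq> end_edge (\<not> z) v) \<and>
          (\<forall>f<n. (?t(h := Some (\<not> z))) (mirror f) = (?t(h := Some (\<not> z))) f) \<and>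
          (\<forall>f<n. mirror f = f \<longrightarrow> (?t(h := Some (\<not> z))) f \<noteq> None)"
        proof (cases "\<exists>g<n. s g \<noteq> None")
          case True
          then obtain g where g: "g < n" "s g \<noteq> None"
            by blast
          then have gz: "(g < k) = (\<not> z)"
            using s_z[of g] by (cases z; cases "g < k") auto
          have s_None: "s f = None \<longleftrightarrow> f \<noteq> g" if "f < n" for f
            using one[OF that g(1) _ g(2)] g(2) by metis
          then have "{f. f < n \<and> s f = None} = {..<n} - {g}"
            by auto
          then have "odd n"
            using s_even unmarked_B[of s] chord g(1) by simp
          then have no_fixed: "mirror f \<noteq> f" if "f < n" "(f < k) = (\<not> z)" for f
            using that len unfolding mirror_def by (cases z; simp; presburger)
          have s_g: "s f = (if f = g then Some (\<not> z) else None)" if "f < n" for f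
            using s_None[OF that] val[OF that] gz by auto
          note m = mirror_props[OF g(1)]
          have "(?t(mirror g := Some (\<not> z))) (mirror f) = (?t(mirror g := Some (\<not> z))) f" if "f < n" for f
          proof -
            have "mirror f = e \<longleftrightarrow> f = e" "mirror f = g \<longleftrightarrow> f = mirror g" "mirror f = mirror g \<longleftrightarrow> f = g"
              using mirror_props(3)[OF that] mirror_e m(3) by metis+
            then show ?thesis
              using s_g[OF that] s_g[OF mirror_props(1)[OF that]] d gz z_def by auto
          qed
          moreover have "?t f \<noteq> None" if "f < n" "mirror f = f" for f
            using fixed[OF that(1) _ that(2)] no_fixed[OF that(1)] that(2) by auto
          moreover have "mirror g \<noteq> end_edge (\<not> z) v" for v
            using m(3) s_end g(2) by (metis mirror_end_edge)
          ultimately show ?thesis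
            using m gz s_g[OF m(1)] no_fixed[OF g(1) gz] by (intro exI[of _ "mirror g"]) auto
        next
          case False
          then have none: "s f = None" if "f < n" for f
            using that by blast
          have "{f. f < n \<and> s f = None} = {..<n}"
            using none by auto
          then have "even n"
            using s_even unmarked_B[of s] chord by simp
          \<comment> \<open>The midpoint of the edges from \<open>k\<close> to \<open>n - 1\<close>,
            or from 0 to \<open>k - 1\<close>; it is exact because the other path has odd
            length.\<close>
          then have "\<exists>h<n. (h < k) = (\<not> z) \<and> mirror h = h"
            using len n_ge k_ge unfolding mirror_def
            by (intro exI[of _ "if z then (n + k - 1) div 2 else (k - 1) div 2"])
              (cases z; simp; presburger)
          then obtain h where h: "h < n" "(h < k) = (\<not> z)" "mirror h = h"
            by blast
          have unique: "f = h" if "f < n" "(f < k) = (\<not> z)" "mirror f = f" for f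
            using that h unfolding mirror_def by (auto split: if_splits)
          have "(?t(h := Some (\<not> z))) (mirror f) = (?t(h := Some (\<not> z))) f" if "f < n" for f
          proof -
            have "mirror f = e \<longleftrightarrow> f = e" "mirror f = h \<longleftrightarrow> f = h"
              using mirror_props(3)[OF that] mirror_e h(3) by metis+
            then show ?thesis
              using none[OF that] none[OF mirror_props(1)[OF that]] by auto
          qed
          moreover have "(?t(h := Some (\<not> z))) f \<noteq> None" if "f < n" "mirror f = f" for f
            using fixed[OF that(1) _ that(2)] unique[OF that(1) _ that(2)] by auto
          moreover have "h \<noteq> end_edge (\<not> z) v" for v
            using h(3) by auto
          ultimately show ?thesis
            using h none by blast
        qed
        then obtain h where h: "h < n" "(h < k) = (\<not> z)" "s h = None" "\<And>v. h \<noteq> end_edge (\<not> z) v"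
          and sym: "\<And>f. f < n \<Longrightarrow> (?t(h := Some (\<not> z))) (mirror f) = (?t(h := Some (\<not> z))) f"
          and mid: "\<And>f. f < n \<Longrightarrow> mirror f = f \<Longrightarrow> (?t(h := Some (\<not> z))) f \<noteq> None"
          by blast
        let ?u = "?t(h := Some (\<not> z))"
        have he: "h \<noteq> e"
          using h(2) z_def by auto
        \<comment> \<open>All arrows on the cycle carry the same raw mark, opposed on path
          \<open>z\<close> and aligned on the other, so nothing conflicts.\<close>
        have u_f: "?u f = Some (\<not> z)" if "f < n" "?u f \<noteq> None" for f
          using that s_z[of f] val[of f] d by (auto split: if_splits)
        have c: "consistent ?u"
        proof (rule consistent_if_uniform)
          show "?u f = ?u g" if "f < n" "g < n" "?u f \<noteq> None" "?u g \<noteq> None" for f g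
            using u_f that by metis
          have "?u (end_edge z v) \<noteq> Some z" for v
            using u_f[of "end_edge z v"] end_edge_props(1)[of z v] by (metis option.distinct(1) option.inject)
          then show "\<exists>z. ?u (end_edge z v) \<noteq> Some z" for v
            by blast
        qed
        have u_n: "?u n = Some True"
          using t_n h(1) by simp
        have l': "legal_move B ?t h (\<not> z)"
          using c h he t_n by (simp add: legal_iff)
        have "has_cycle_cell B ?u \<or> mirrored ?u"
        proof (cases "\<exists>y. full y ?u")
          case True
          then show ?thesis
            using has_cycle_cell_B[of ?u] u_n by blast
        next
          case False
          then show ?thesis
            using c u_n sym mid unfolding mirrored_def by blast
        qed
        then show ?thesis
          using l' mirrored_lost unfolding reply_def by blast
      qed
    qed
  qed
  then show "\<not> has_cycle_cell B ?t \<and> reply B (lost B) ?t"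
    using nf by (simp only: has_cycle_cell_B[of ?t] t_n) simp
qed

section \<open>Opening moves\<close>

lemma unmarked_chord: "unmarked B ((\<lambda>_. None)(n := Some True)) = n"
proof -
  have "{e. e < n \<and> ((\<lambda>_. None)(n := Some True)) e = None} = {..<n}"
    by auto
  then show ?thesis
    by (subst unmarked_B) simp_all
qed

lemma chord_first:
  assumes "even n"
  shows "reply B (lost B) (\<lambda>_. None)"
proof -
  let ?t = "(\<lambda>_. None)(n := Some True)"
  have t_n: "?t n = Some True" and t_None: "\<And>e. e < n \<Longrightarrow> ?t e = None"
    by auto
  have f: "fresh ?t"
    using assms t_None t_n unmarked_chord unfolding fresh_def by simp
  then have "legal_move B (\<lambda>_. None) n True"
    using fresh_consistent consistent_iff[of ?t] t_n by (auto simp: legal_move_def)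
  then show ?thesis
    using fresh_lost[OF f] unfolding reply_def by blast
qed

text \<open>Only an opening arrow that is aligned with the chord mark \<open>True\<close> is
  treated; the opposite arrow is covered by reversal.\<close>

lemma chord_answer:
  assumes "odd n" "e < n"
  shows "reply B (lost B) ((\<lambda>_. None)(e := Some (e < k)))"
proof -
  let ?s = "(\<lambda>_. None)(e := Some (e < k))"
  let ?t = "?s(n := Some True)"
  have t_n: "?t n = Some True"
    by simp
  have t_e: "?t f = (if f = e then Some (e < k) else None)" if "f < n" for f
    using that by simp
  have c: "consistent ?t"
  proof (rule consistent_if_uniform)
    show "?t f = ?t g" if "f < n" "g < n" "(f < k) = (g < k)" "?t f \<noteq> None" "?t g \<noteq> None" for f g
      using that t_e by metis
    have "end_edge True v \<noteq> e \<or> end_edge False v \<noteq> e" for v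
      using end_edge_props(3) by metis
    then show "\<exists>z. ?t (end_edge z v) \<noteq> Some z" for v
      using t_e end_edge_props(1) by (metis option.distinct(1))
  qed
  have l: "legal_move B ?s n True"
    using c consistent_iff[of ?t] assms t_n by (simp add: legal_move_def)
  have "{f. f < n \<and> ?t f = None} = {..<n} - {e}"
    using t_e by auto
  then have even: "even (unmarked B ?t)"
    using unmarked_B[of ?t] t_n assms by simp
  have no_opposed: "?t f \<noteq> Some (\<not> (f < k))" if "f < n" for f
    using t_e[OF that] by auto
  have "lost B ?t"
  \<comment> \<open>An aligned arrow on an end edge has settled that chord end already; otherwise
    the position is \<open>fresh\<close>.\<close>
  proof (cases "\<exists>z v. e = end_edge z v")
    case True
    then obtain z v where zv: "e = end_edge z v"
      by blast
    have "settled v ?t"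
      unfolding settled_def using zv t_e[OF assms(2)] by (metis end_edge_props(2))
    moreover have "\<not> nearly_full y ?t" for y
      using no_opposed by (intro not_nearly_full_if_no_opposed) blast
    moreover have "?t (end_edge y (\<not> v)) \<noteq> Some (\<not> y) \<and> ?t (second_edge y (\<not> v)) \<noteq> Some (\<not> y)" for y
      using no_opposed by (metis end_edge_props(1,2) second_edge_props(1,2))
    ultimately have "half_secure v ?t"
      using t_n c even unfolding half_secure_def by blast
    then show ?thesis
      by (rule half_secure_lost)
  next
    case False
    have "fresh ?t"
      unfolding fresh_def
    proof (intro conjI allI impI)
      show "?t f = Some (f < k)" if "f < n" "?t f \<noteq> None" for f
        using t_e[OF that(1)] that(2) by metis
      show "f \<noteq> end_edge z v" if "f < n" "?t f \<noteq> None" for f z v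
        using t_e[OF that(1)] that(2) False by metis
      show "f = g" if "f < n" "g < n" "?t f \<noteq> None" "?t g \<noteq> None" for f g
        using t_e that by metis
    qed (use t_n even in blast)+
    then show ?thesis
      by (rule fresh_lost)
  qed
  then show ?thesis
    using l unfolding reply_def by blast
qed

lemma edge_answer:
  assumes "odd n"
  shows "reply B (lost B) ((\<lambda>_. None)(n := Some True))"
proof -
  let ?t = "(\<lambda>_. None)(n := Some True)"
  have t_n: "?t n = Some True" and t_None: "\<And>e. e < n \<Longrightarrow> ?t e = None"
    by auto
  have c: "consistent ?t"
    using t_None by (intro consistent_if_uniform) auto
  have odd: "odd (unmarked B ?t)"
    using assms unmarked_chord by simp
  show ?thesis
  proof (rule half_secure_reply[OF t_n c odd, of True True])
    show "\<not> nearly_full y ?t" for y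
      using t_None by (intro not_nearly_full_if_no_opposed) simp
  qed (simp_all only: t_None end_edge_props(1) second_edge_props(1) option.distinct simp_thms)
qed

lemma no_cell_after_first_move: "\<not> has_cycle_cell B ((\<lambda>_. None)(e := Some d))"
proof (cases "e = n")
  case True
  have "\<not> full z ((\<lambda>_. None)(n := Some True))" for z
    unfolding full_def by (metis end_edge_props(1,2) fun_upd_other less_irrefl option.distinct(1))
  then have nc: "\<not> has_cycle_cell B ((\<lambda>_. None)(n := Some True))"
    by (simp add: has_cycle_cell_B)
  moreover have "reverse ((\<lambda>_. None)(n := Some True)) = (\<lambda>_. None)(n := Some False)"
    by (auto simp: reverse_def)
  ultimately have "\<not> has_cycle_cell B ((\<lambda>_. None)(n := Some False))"
    by (metis has_cycle_cell_reverse)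
  then show ?thesis
    using nc True by (cases d) simp_all
qed (simp add: no_cycle_cell_chord_unmarked)

lemma first_player_wins_even:
  assumes "even n"
  shows "first_player_wins B"
  unfolding first_player_wins_def
  by (rule reply_imp_mover_wins[OF _ chord_first[OF assms]]) (simp_all add: unmarked_def)

lemma second_player_wins_odd:
  assumes "odd n"
  shows "second_player_wins B"
  unfolding second_player_wins_def
proof (intro allI impI)
  fix e :: nat and d :: bool
  let ?s = "\<lambda>b. (\<lambda>_. None)(e := Some b)"
  assume l: "legal_move B (\<lambda>_. None) e d"
  then have e: "e \<le> n"
    by (simp add: legal_move_def)
  \<comment> \<open>The mark of the opening arrow in the normalized position. If \<open>d\<close>
    differs from it, \<open>mover_wins_reverse\<close> transfers the outcome.\<close>
  define b where "b = (if e = n then True else e < k)"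
  have "reply B (lost B) (?s b)"
    using chord_answer[OF assms] edge_answer[OF assms] e by (cases "e = n") (auto simp: b_def)
  moreover have "{x \<in> {..n}. ?s b x = None} = {..n} - {e}"
    by auto
  then have "unmarked B (?s b) = n"
    using e by (simp add: unmarked_def)
  ultimately have "mover_wins B n (?s b)"
    by (intro reply_imp_mover_wins) simp_all
  moreover have "reverse (?s b) = ?s (\<not> b)"
    by (auto simp: reverse_def)
  ultimately have w: "mover_wins B n (?s d)"
    using mover_wins_reverse[of B n "?s b"] by (cases "d = b") auto
  moreover from w have "has_move B (?s d)"
    by (cases n) (auto simp: has_move_def)
  ultimately show "\<not> has_cycle_cell B (?s d) \<and> has_move B (?s d) \<and> mover_wins B (card (bedges B) - 1) (?s d)"
    using no_cell_after_first_move by simp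
qed

end

theorem theorem4p4:
  fixes n k :: nat
  assumes "4 \<le> n" and "2 \<le> k" and "k \<le> n - 2"
  shows "(even n \<longrightarrow> first_player_wins (chord_board n k)) \<and>
         (odd n \<longrightarrow> second_player_wins (chord_board n k))"
proof -
  interpret chord_game n k
    using assms by unfold_locales auto
  show ?thesis
    using first_player_wins_even second_player_wins_odd by blast
qed

end
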